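(* Let $H$ be a sub-skew brace of a finite skew left brace $B$. Then $\mathrm{Pb}(B)\leqslant\mathrm{Pb}(H)$.
   Context: A skew left brace is a set $B$ with two group structures $(B,+)$ and $(B,\circ)$ (neither assumed abelian) such that $a\circ(b+c)=(a\circ b)-a+(a\circ c)$ for all $a,b,c\in B$, where $-a$ is the inverse of $a$ in $(B,+)$. The identities of the two groups coincide and are denoted by $1$. A sub-skew brace of $B$ is a subset $H$ such that $(H,+,\circ)$ is itself a skew left brace, i.e. $H$ is a subgroup of both $(B,+)$ and $(B,\circ)$. Put $a*b:=-a+(a\circ b)-b$ and $[a,b]^+:=a+b-a-b$. For a finite skew left brace $B$, the commuting probability is $$\mathrm{Pb}(B):=\frac{1}{|B|^2}\,\bigl|\{(a,b)\in B\times B \mid a*b=b*a=[a,b]^+=1\}\bigr|.$$ *)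

theory Defs
  imports Complex_Main "HOL-Algebra.Ring"
begin

text \<open>
  The record type of HOL-Algebra rings serves here only as raw data for a set with two operations
  (no ring axioms are assumed): \<open>\<oplus>\<close> is the operation + of the skew brace, and
  \<open>\<otimes>\<close> is its operation \<open>\<circ>\<close>. Thus \<open>\<ominus> a\<close> is the inverse of
  \<open>a\<close> in \<open>(B,+)\<close>, and \<open>x \<ominus> y\<close> is \<open>x \<oplus> (\<ominus> y)\<close>.
\<close>

locale skew_left_brace =
  fixes B :: "('a, 'b) ring_scheme" (structure)
  assumes add_group: "group (add_monoid B)"
    and circ_group: "group B"
    and brace: "\<lbrakk>a \<in> carrier B; b \<in> carrier B; c \<in> carrier B\<rbrakk> \<Longrightarrow>
      a \<otimes> (b \<oplus> c) = ((a \<otimes> b) \<ominus> a) \<oplus> (a \<otimes> c)"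

text \<open>
  The identities of the two groups, separate fields of the record, coincide; either one may be
  used for the identity \<open>1\<close>.
\<close>

lemma (in skew_left_brace) zero_eq_one: "\<zero> = \<one>"
proof -
  interpret A: group "add_monoid B" by (rule add_group)
  interpret M: group B by (rule circ_group)
  have z: "\<zero> \<in> carrier B" and o: "\<one> \<in> carrier B"
    using A.one_closed by simp_all
  have inv: "\<ominus> x \<in> carrier B" if "x \<in> carrier B" for x
    using A.inv_closed that by (simp add: a_inv_def)
  have "\<one> \<otimes> (\<zero> \<oplus> \<zero>) = ((\<one> \<otimes> \<zero>) \<ominus> \<one>) \<oplus> (\<one> \<otimes> \<zero>)"
    using brace[OF o z z] .
  moreover have "\<zero> \<oplus> \<zero> = \<zero>"
    using A.l_one z by simp
  moreover have "(\<zero> \<oplus> (\<ominus> \<one>)) \<oplus> \<zero> = \<ominus> \<one>"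
    using A.l_one A.r_one inv[OF o] by simp
  ultimately have "\<ominus> \<one> = \<zero>"
    using z by (simp add: a_minus_def)
  then show ?thesis
    using A.r_inv A.r_one o by (metis a_inv_def monoid.select_convs(1,2) partial_object.select_convs(1))
qed

definition sub_skew_brace :: "'a set \<Rightarrow> ('a, 'b) ring_scheme \<Rightarrow> bool" where
  "sub_skew_brace H B \<longleftrightarrow> H \<subseteq> carrier B \<and> skew_left_brace (B\<lparr>carrier := H\<rparr>)"

lemma (in skew_left_brace) sub_skew_brace_iff:
  "sub_skew_brace H B \<longleftrightarrow> subgroup H (add_monoid B) \<and> subgroup H B"
proof -
  interpret A: group "add_monoid B" by (rule add_group)
  interpret M: group B by (rule circ_group)
  have eq: "add_monoid (B\<lparr>carrier := H\<rparr>) = (add_monoid B)\<lparr>carrier := H\<rparr>"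
    by simp
  show ?thesis
  proof
    assume "sub_skew_brace H B"
    then have H: "H \<subseteq> carrier B" and S: "skew_left_brace (B\<lparr>carrier := H\<rparr>)"
      by (auto simp: sub_skew_brace_def)
    have "group ((add_monoid B)\<lparr>carrier := H\<rparr>)"
      using skew_left_brace.add_group[OF S] by (simp only: eq)
    then show "subgroup H (add_monoid B) \<and> subgroup H B"
      using A.group_incl_imp_subgroup M.group_incl_imp_subgroup H skew_left_brace.circ_group[OF S]
      by simp
  next
    assume *: "subgroup H (add_monoid B) \<and> subgroup H B"
    then have H: "H \<subseteq> carrier B"
      using subgroup.subset by blast
    have inv: "\<ominus>\<^bsub>B\<lparr>carrier := H\<rparr>\<^esub> x = \<ominus> x" if "x \<in> H" for x
      using A.m_inv_consistent[of H x] * that by (simp add: a_inv_def)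
    have "skew_left_brace (B\<lparr>carrier := H\<rparr>)"
    proof (rule skew_left_brace.intro)
      show "group (add_monoid (B\<lparr>carrier := H\<rparr>))"
        using A.subgroup_imp_group * by (simp only: eq)
      show "group (B\<lparr>carrier := H\<rparr>)"
        using M.subgroup_imp_group * by simp
    next
      fix a b c
      assume "a \<in> carrier (B\<lparr>carrier := H\<rparr>)" "b \<in> carrier (B\<lparr>carrier := H\<rparr>)"
        "c \<in> carrier (B\<lparr>carrier := H\<rparr>)"
      then show "a \<otimes>\<^bsub>B\<lparr>carrier := H\<rparr>\<^esub> (b \<oplus>\<^bsub>B\<lparr>carrier := H\<rparr>\<^esub> c) =
        (a \<otimes>\<^bsub>B\<lparr>carrier := H\<rparr>\<^esub> b \<ominus>\<^bsub>B\<lparr>carrier := H\<rparr>\<^esub> a)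
          \<oplus>\<^bsub>B\<lparr>carrier := H\<rparr>\<^esub> (a \<otimes>\<^bsub>B\<lparr>carrier := H\<rparr>\<^esub> c)"
        using brace[of a b c] H inv[of a] by (auto simp: a_minus_def)
    qed
    with H show "sub_skew_brace H B"
      by (simp add: sub_skew_brace_def)
  qed
qed

definition star :: "('a, 'b) ring_scheme \<Rightarrow> 'a \<Rightarrow> 'a \<Rightarrow> 'a" where
  "star B a b = ((\<ominus>\<^bsub>B\<^esub> a) \<oplus>\<^bsub>B\<^esub> (a \<otimes>\<^bsub>B\<^esub> b)) \<ominus>\<^bsub>B\<^esub> b"

definition add_commutator :: "('a, 'b) ring_scheme \<Rightarrow> 'a \<Rightarrow> 'a \<Rightarrow> 'a" where
  "add_commutator B a b = ((a \<oplus>\<^bsub>B\<^esub> b) \<ominus>\<^bsub>B\<^esub> a) \<ominus>\<^bsub>B\<^esub> b"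

definition Pb :: "('a, 'b) ring_scheme \<Rightarrow> real" where
  "Pb B = real (card {(a, b) \<in> carrier B \<times> carrier B.
      star B a b = \<one>\<^bsub>B\<^esub> \<and> star B b a = \<one>\<^bsub>B\<^esub> \<and> add_commutator B a b = \<one>\<^bsub>B\<^esub>})
    / (real (card (carrier B)))\<^sup>2"

end

theory Submission
  imports Defs
begin

text \<open>
  The pair \<open>(a, b)\<close> is counted by \<^const>\<open>Pb\<close> exactly when \<open>a \<oplus> b\<close>, \<open>b \<oplus> a\<close>,
  \<open>a \<otimes> b\<close> and \<open>b \<otimes> a\<close> are all equal (\<open>skew_left_brace.commuting_iff\<close>); write \<open>C(b)\<close> for
  the set of such \<open>a\<close>. The main point is that \<open>C(b)\<close> is a subgroup of the circle group
  (\<open>skew_left_brace.subgroup_centralizer\<close>). After that the argument is the one for commuting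
  probabilities of groups, and it uses nothing about the relation except that it is symmetric and
  that its sections are subgroups (\<open>group.subgroup_sections_density_le\<close>).

  For subgroups \<open>C\<close>, \<open>H\<close> of a finite group \<open>G\<close> the index of \<open>C \<inter> H\<close> in \<open>H\<close> is at most the
  index of \<open>C\<close> in \<open>G\<close>, so \<open>|C(b)| |H| \<le> |G| |C(b) \<inter> H|\<close>. Summed over all \<open>b \<in> G\<close>, this bounds
  the number of related pairs in \<open>G \<times> G\<close> by \<open>|G| / |H|\<close> times the number of those in
  \<open>H \<times> G\<close>. By symmetry the latter number is the sum of \<open>|C(h)|\<close> over \<open>h \<in> H\<close>, and the same
  inequality applies once more.
\<close>

text \<open>
  This is the index inequality \<open>[H : C \<inter> H] \<le> [G : C]\<close> without quotients. Two factorisations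
  \<open>c \<otimes> h = c' \<otimes> h'\<close> of the same element differ by \<open>inv c' \<otimes> c = h' \<otimes> inv h\<close>, an element of
  \<open>C \<inter> H\<close>, so each fibre of the multiplication \<open>C \<times> H \<rightarrow> G\<close> has at most
  \<open>|C \<inter> H|\<close> elements.
\<close>

lemma (in group) card_subgroups_mult_le:
  assumes fin: "finite (carrier G)" and C: "subgroup C G" and H: "subgroup H G"
  shows "card C * card H \<le> card (carrier G) * card (C \<inter> H)"
proof -
  have sub: "C \<subseteq> carrier G" "H \<subseteq> carrier G"
    using C H subgroup.subset by blast+
  have finCH: "finite C" "finite H"
    using sub fin finite_subset by blast+
  define F where "F g = {(c, h) \<in> C \<times> H. c \<otimes> h = g}" for g
  have fibre: "card (F g) \<le> card (C \<inter> H)" for g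
  proof (cases "F g = {}")
    case False
    then obtain c0 h0 where 0: "c0 \<in> C" "h0 \<in> H" "c0 \<otimes> h0 = g"
      by (auto simp: F_def)
    have eq: "inv c0 \<otimes> c = h0 \<otimes> inv h" if "c \<in> C" "h \<in> H" "c \<otimes> h = g" for c h
    proof -
      have car: "c0 \<in> carrier G" "h0 \<in> carrier G" "c \<in> carrier G" "h \<in> carrier G"
        using sub 0 that by auto
      moreover have "c \<otimes> h = c0 \<otimes> h0"
        using 0 that by simp
      ultimately have "inv c0 \<otimes> c \<otimes> h = h0"
        by (simp add: m_assoc inv_solve_left')
      then show ?thesis
        using car by (simp add: inv_solve_right)
    qed
    show ?thesis
    proof (rule card_inj_on_le)
      show "inj_on (\<lambda>(c, h). inv c0 \<otimes> c) (F g)"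
      proof (rule inj_onI, clarify)
        fix c h c' h'
        assume *: "(c, h) \<in> F g" "(c', h') \<in> F g" "inv c0 \<otimes> c = inv c0 \<otimes> c'"
        then have m: "c \<in> carrier G" "h \<in> carrier G" "c' \<in> carrier G" "h' \<in> carrier G"
          "c0 \<in> carrier G" "c \<otimes> h = c' \<otimes> h'"
          using sub 0 by (auto simp: F_def)
        then have "c = c'"
          using * by simp
        then show "c = c' \<and> h = h'"
          using m by simp
      qed
      show "(\<lambda>(c, h). inv c0 \<otimes> c) ` F g \<subseteq> C \<inter> H"
      proof clarify
        fix c h assume "(c, h) \<in> F g"
        then have *: "c \<in> C" "h \<in> H" "c \<otimes> h = g"
          by (auto simp: F_def)
        have "inv c0 \<otimes> c \<in> C" "h0 \<otimes> inv h \<in> H"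
          using * 0 C H by (auto intro: subgroup.m_closed subgroup.m_inv_closed)
        then show "inv c0 \<otimes> c \<in> C \<inter> H"
          using eq[OF *] by simp
      qed
    qed (use finCH in simp)
  qed simp
  have "C \<times> H = (\<Union>g\<in>carrier G. F g)"
    using sub by (auto simp: F_def subset_iff)
  then have "card C * card H = card (\<Union>g\<in>carrier G. F g)"
    by (metis card_cartesian_product)
  also have "\<dots> \<le> (\<Sum>g\<in>carrier G. card (F g))"
    by (rule card_UN_le[OF fin])
  also have "\<dots> \<le> card (carrier G) * card (C \<inter> H)"
    using sum_bounded_above[of "carrier G" "\<lambda>g. card (F g)"] fibre by simp
  finally show ?thesis .
qed

lemma (in group) subgroup_sections_density_le:
  assumes fin: "finite (carrier G)" and H: "subgroup H G"
    and sym: "\<And>a b. \<lbrakk>a \<in> carrier G; b \<in> carrier G; R a b\<rbrakk> \<Longrightarrow> R b a"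
    and sections: "\<And>b. b \<in> carrier G \<Longrightarrow> subgroup {a \<in> carrier G. R a b} G"
  shows "card {(a, b) \<in> carrier G \<times> carrier G. R a b} * (card H)\<^sup>2
    \<le> card {(a, b) \<in> H \<times> H. R a b} * (card (carrier G))\<^sup>2"
proof -
  have sub: "H \<subseteq> carrier G"
    using H subgroup.subset by blast
  have finH: "finite H"
    using sub fin finite_subset by blast
  have count: "card {(a, b) \<in> X \<times> Y. R a b} = (\<Sum>b\<in>Y. card {a \<in> X. R a b})"
    if "finite X" "finite Y" for X Y
  proof -
    have "{(a, b) \<in> X \<times> Y. R a b} = prod.swap ` (SIGMA b:Y. {a \<in> X. R a b})"
      by force
    then have "card {(a, b) \<in> X \<times> Y. R a b} = card (SIGMA b:Y. {a \<in> X. R a b})"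
      by (simp add: card_image)
    then show ?thesis
      using that by simp
  qed
  have section_le: "card {a \<in> carrier G. R a b} * card H \<le> card (carrier G) * card {a \<in> H. R a b}"
    if "b \<in> carrier G" for b
  proof -
    have "{a \<in> carrier G. R a b} \<inter> H = {a \<in> H. R a b}"
      using sub by blast
    then show ?thesis
      using card_subgroups_mult_le[OF fin sections[OF that] H] by simp
  qed
  have step: "card {(a, b) \<in> carrier G \<times> Y. R a b} * card H
      \<le> card (carrier G) * card {(a, b) \<in> H \<times> Y. R a b}" if "Y \<subseteq> carrier G" for Y
  proof -
    have "finite Y"
      using that fin finite_subset by blast
    moreover have "(\<Sum>b\<in>Y. card {a \<in> carrier G. R a b} * card H)
        \<le> (\<Sum>b\<in>Y. card (carrier G) * card {a \<in> H. R a b})"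
      using that by (intro sum_mono section_le) blast
    ultimately show ?thesis
      by (simp only: count fin finH sum_distrib_left sum_distrib_right)
  qed
  have "{(a, b) \<in> H \<times> carrier G. R a b} = prod.swap ` {(a, b) \<in> carrier G \<times> H. R a b}"
    using sub sym by force
  then have swap: "card {(a, b) \<in> H \<times> carrier G. R a b} = card {(a, b) \<in> carrier G \<times> H. R a b}"
    by (simp add: card_image)
  have "card {(a, b) \<in> carrier G \<times> carrier G. R a b} * (card H)\<^sup>2
      \<le> card (carrier G) * card {(a, b) \<in> H \<times> carrier G. R a b} * card H"
    using mult_right_mono[OF step[of "carrier G"], of "card H"]
    by (simp add: power2_eq_square mult.assoc)
  also have "\<dots> = card (carrier G) * (card {(a, b) \<in> carrier G \<times> H. R a b} * card H)"
    by (simp only: swap mult.assoc)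
  also have "\<dots> \<le> card (carrier G) * (card (carrier G) * card {(a, b) \<in> H \<times> H. R a b})"
    using step[OF sub] by (rule mult_left_mono) simp
  finally show ?thesis
    by (simp add: power2_eq_square mult_ac)
qed

definition commuting :: "('a, 'b) ring_scheme \<Rightarrow> 'a \<Rightarrow> 'a \<Rightarrow> bool" where
  "commuting B a b \<longleftrightarrow> star B a b = \<one>\<^bsub>B\<^esub> \<and> star B b a = \<one>\<^bsub>B\<^esub>
    \<and> add_commutator B a b = \<one>\<^bsub>B\<^esub>"

lemma (in skew_left_brace) commuting_iff:
  assumes a: "a \<in> carrier B" and b: "b \<in> carrier B"
  shows "commuting B a b \<longleftrightarrow> a \<otimes> b = a \<oplus> b \<and> b \<otimes> a = a \<oplus> b \<and> b \<oplus> a = a \<oplus> b"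
proof -
  interpret A: group "add_monoid B"
    rewrites "carrier (add_monoid B) = carrier B" and "mult (add_monoid B) = add B"
      and "one (add_monoid B) = zero B" and "m_inv (add_monoid B) = a_inv B"
    by (rule add_group) (auto simp: a_inv_def)
  interpret M: group B by (rule circ_group)
  have star_eq: "star B x y = \<one> \<longleftrightarrow> x \<otimes> y = x \<oplus> y" if "x \<in> carrier B" "y \<in> carrier B" for x y
    using that unfolding star_def a_minus_def zero_eq_one[symmetric]
    by (simp add: A.inv_solve_right' A.inv_solve_left')
  have "add_commutator B a b = \<one> \<longleftrightarrow> a \<oplus> b = b \<oplus> a"
    using a b unfolding add_commutator_def a_minus_def zero_eq_one[symmetric]
    by (simp add: A.inv_solve_right')
  then show ?thesis
    using a b star_eq[of a b] star_eq[of b a] by (auto simp: commuting_def)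
qed

text \<open>
  Left multiplication by \<open>a\<close> is not additive, but for \<open>a\<close> commuting with \<open>b\<close> the brace identity
  gives \<open>a \<otimes> (x \<oplus> b) = (a \<otimes> x) \<oplus> b\<close> and \<open>a \<otimes> (b \<oplus> x) = b \<oplus> (a \<otimes> x)\<close>
  for every \<open>x\<close>, because \<open>a \<otimes> b = a \<oplus> b = b \<oplus> a\<close> lets \<open>a\<close> cancel against \<open>\<ominus> a\<close>.
  If \<open>x\<close> also commutes with \<open>b\<close>, the left sides agree with each other and with
  \<open>a \<otimes> x \<otimes> b = b \<otimes> (a \<otimes> x)\<close>, so \<open>a \<otimes> x\<close> commutes with \<open>b\<close>. For \<open>x = inv a\<close> both right
  sides are \<open>b\<close>, and so are \<open>a \<otimes> (x \<otimes> b)\<close> and \<open>a \<otimes> (b \<otimes> x)\<close>; cancelling \<open>a\<close> shows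
  that \<open>inv a\<close> commutes with \<open>b\<close>.
\<close>

lemma (in skew_left_brace) subgroup_centralizer:
  assumes b: "b \<in> carrier B"
  shows "subgroup {a \<in> carrier B. commuting B a b} B"
proof -
  interpret A: group "add_monoid B"
    rewrites "carrier (add_monoid B) = carrier B" and "mult (add_monoid B) = add B"
      and "one (add_monoid B) = zero B" and "m_inv (add_monoid B) = a_inv B"
    by (rule add_group) (auto simp: a_inv_def)
  interpret M: group B by (rule circ_group)
  have shift: "a \<otimes> (x \<oplus> b) = (a \<otimes> x) \<oplus> b" "a \<otimes> (b \<oplus> x) = b \<oplus> (a \<otimes> x)"
    if a: "a \<in> carrier B" and x: "x \<in> carrier B" and ab: "commuting B a b" for a x
  proof -
    note c = ab[unfolded commuting_iff[OF a b]]
    have "a \<otimes> (x \<oplus> b) = (a \<otimes> x \<ominus> a) \<oplus> (a \<oplus> b)"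
      using brace[OF a x b] c by simp
    also have "\<dots> = (a \<otimes> x) \<oplus> (\<ominus> a \<oplus> (a \<oplus> b))"
      using a x b by (simp add: a_minus_def A.m_assoc)
    also have "\<ominus> a \<oplus> (a \<oplus> b) = b"
      using a b by (simp add: A.inv_solve_left')
    finally show "a \<otimes> (x \<oplus> b) = (a \<otimes> x) \<oplus> b" .
    have "a \<otimes> (b \<oplus> x) = (b \<oplus> a \<ominus> a) \<oplus> (a \<otimes> x)"
      using brace[OF a b x] c by simp
    also have "b \<oplus> a \<ominus> a = b"
      using a b by (simp add: a_minus_def A.inv_solve_right')
    finally show "a \<otimes> (b \<oplus> x) = b \<oplus> (a \<otimes> x)" .
  qed
  show ?thesis
  proof (rule M.subgroupI)
    have "commuting B \<one> b"
      using b A.l_one A.r_one by (simp add: commuting_iff flip: zero_eq_one)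
    then show "{a \<in> carrier B. commuting B a b} \<noteq> {}"
      by blast
  next
    fix a assume "a \<in> {a \<in> carrier B. commuting B a b}"
    then have a: "a \<in> carrier B" and ab: "commuting B a b"
      by auto
    note c = ab[unfolded commuting_iff[OF a b]]
    define y where "y = inv a"
    have y: "y \<in> carrier B" and ay: "a \<otimes> y = \<one>"
      using a by (auto simp: y_def)
    have ayb: "a \<otimes> (y \<otimes> b) = b"
      using a b y ay by (simp flip: M.m_assoc)
    have aby: "a \<otimes> (b \<otimes> y) = b"
      using a b y ay c by (metis M.m_assoc M.r_one)
    have "a \<otimes> (y \<oplus> b) = b" "a \<otimes> (b \<oplus> y) = b"
      using shift[OF a y ab] ay b A.l_one A.r_one by (simp_all flip: zero_eq_one)
    then have "y \<otimes> b = y \<oplus> b" "b \<otimes> y = y \<oplus> b" "b \<oplus> y = y \<oplus> b"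
      using a b y ayb aby by (metis M.Units_eq M.Units_l_cancel M.m_closed A.m_closed)+
    then show "inv a \<in> {a \<in> carrier B. commuting B a b}"
      using y b by (simp add: commuting_iff flip: y_def)
  next
    fix a x assume "a \<in> {a \<in> carrier B. commuting B a b}" "x \<in> {a \<in> carrier B. commuting B a b}"
    then have a: "a \<in> carrier B" and ab: "commuting B a b"
      and x: "x \<in> carrier B" and xb: "commuting B x b"
      by auto
    note c = ab[unfolded commuting_iff[OF a b]] and d = xb[unfolded commuting_iff[OF x b]]
    have "a \<otimes> x \<otimes> b = a \<otimes> (x \<oplus> b)"
      using a x b d by (simp add: M.m_assoc)
    moreover have "b \<otimes> (a \<otimes> x) = a \<otimes> (x \<oplus> b)"
      using a x b c d by (metis M.m_assoc)
    ultimately show "a \<otimes> x \<in> {a \<in> carrier B. commuting B a b}"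
      using shift[OF a x ab] a x b d by (simp add: commuting_iff)
  qed auto
qed

lemma (in skew_left_brace) commuting_restrict:
  assumes H: "subgroup H (add_monoid B)" and "a \<in> H" "b \<in> H"
  shows "commuting (B\<lparr>carrier := H\<rparr>) a b \<longleftrightarrow> commuting B a b"
proof -
  have "\<ominus>\<^bsub>B\<lparr>carrier := H\<rparr>\<^esub> x = \<ominus> x" if "x \<in> H" for x
    using group.m_inv_consistent[OF add_group H that] by (simp add: a_inv_def)
  then show ?thesis
    using assms by (simp add: commuting_def star_def add_commutator_def a_minus_def)
qed

theorem proposition3p12:
  fixes B :: "('a, 'b) ring_scheme" and H :: "'a set"
  assumes "skew_left_brace B"
    and "finite (carrier B)"
    and "sub_skew_brace H B"
  shows "Pb B \<le> Pb (B\<lparr>carrier := H\<rparr>)"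
proof -
  interpret skew_left_brace B by (rule assms(1))
  interpret M: group B by (rule circ_group)
  have H: "subgroup H (add_monoid B)" "subgroup H B"
    using assms(3) by (auto simp: sub_skew_brace_iff)
  have pos: "card H > 0" "card (carrier B) > 0"
    using subgroup.finite_imp_card_positive[OF H(2) assms(2)]
      subgroup.finite_imp_card_positive[OF M.subgroup_self assms(2)] by auto
  define m where "m = card {(a, b) \<in> carrier B \<times> carrier B. commuting B a b}"
  define n where "n = card {(a, b) \<in> H \<times> H. commuting B a b}"
  have "m * (card H)\<^sup>2 \<le> n * (card (carrier B))\<^sup>2"
    unfolding m_def n_def
    by (rule M.subgroup_sections_density_le[OF assms(2) H(2) _ subgroup_centralizer])
      (auto simp: commuting_iff)
  then have "real m * (real (card H))\<^sup>2 \<le> real n * (real (card (carrier B)))\<^sup>2"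
    by (simp flip: of_nat_mult of_nat_power)
  then have "real m / (real (card (carrier B)))\<^sup>2 \<le> real n / (real (card H))\<^sup>2"
    using pos by (simp add: field_simps)
  moreover have "Pb B = real m / (real (card (carrier B)))\<^sup>2"
    by (simp add: Pb_def m_def commuting_def)
  moreover have "{(a, b) \<in> H \<times> H. commuting (B\<lparr>carrier := H\<rparr>) a b}
      = {(a, b) \<in> H \<times> H. commuting B a b}"
    using commuting_restrict[OF H(1)] by auto
  then have "Pb (B\<lparr>carrier := H\<rparr>) = real n / (real (card H))\<^sup>2"
    by (simp add: Pb_def n_def commuting_def)
  ultimately show ?thesis
    by simp
qed

end
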